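(* Let $0<p<\infty$, let $\sigma_1,\sigma_2$ be weight functions on $T$, let $\varphi:T\to T$ be a self map and $\psi:T\to\mathbb{C}$ a function, and let $W_{\psi,\varphi}(f)=\psi\,(f\circ\varphi)$. The operator $W_{\psi,\varphi}:\mathbb{T}_{\sigma_1,\infty}\to\mathbb{T}_{\sigma_2,p}$ is compact if and only if $$\sup_{n\in\mathbb{N}_0}\frac{1}{c_n}\sum_{|x|=n,\ |\varphi(x)|\ge m}\left|\frac{\sigma_2(x)\psi(x)}{\sigma_1(\varphi(x))}\right|^p\to0\quad\text{as } m\to\infty.$$
   Context: $T$ is an infinite rooted tree, identified with its vertex set; $|x|$ is the edge-counting distance from the root $o$ to the vertex $x$; $c_n$ is the number of vertices $x$ with $|x|=n$, $n\in\mathbb{N}_0=\{0,1,2,\dots\}$. Standing assumptions: every $c_n$ is finite and the sequence $\{c_n\}$ is unbounded. A weight function is a function $\sigma:T\to(0,\infty)$. For a weight $\sigma$, $0<p<\infty$ and $f:T\to\mathbb{C}$, put $M_{\sigma,p}(n,f)=\left(\frac{1}{c_n}\sum_{|x|=n}\sigma(x)^p|f(x)|^p\right)^{1/p}$ and $\|f\|_{\sigma,p}=\sup_{n\in\mathbb{N}_0}M_{\sigma,p}(n,f)$; for $p=\infty$ put $\|f\|_{\sigma,\infty}=\sup_{x\in T}\sigma(x)|f(x)|$. For $0<p\le\infty$, the space $\mathbb{T}_{\sigma,p}$ is the set of all $f:T\to\mathbb{C}$ with $\|f\|_{\sigma,p}<\infty$. That a linear operator $A:X\to Y$ between such spaces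 is compact means that $Af\in Y$ for every $f\in X$ and that for every bounded sequence $(f_n)$ in $X$ the sequence $(Af_n)$ has a subsequence converging in $Y$ with respect to $\|\cdot\|_Y$. Sums over the empty set are $0$.
   Formalization: The formal theorem additionally assumes that W maps T_{σ1,∞} into T_{σ2,p}; without this the "if" direction fails, e.g. for φ constantly the root, σ1=1, ψ(x)=|x|/σ2(x), where the limit is 0 but W(1)=ψ is not in T_{σ2,p}. *)

theory Defs
  imports
    Complex_Main
    "HOL-Library.Extended_Nonnegative_Real"
    "Graph_Theory.Digraph_Component"
begin

text \<open>Undirected graphs are symmetric digraphs, so every edge gives a closed walk of length 2;
  only cycles of length at least 3 are cycles of the undirected graph. (For the same reason the
  library predicates \<open>forest\<close> and \<open>tree\<close> do not fit here.) The tree is identified with its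
  vertex set, which is the whole type.\<close>

locale rooted_tree = pair_bidirected_digraph G
  for G :: "'v pair_pre_digraph" +
  fixes rt :: 'v
  assumes verts_UNIV: "pverts G = UNIV"
    and connected: "Digraph_Component.connected (with_proj G)"
    and no_cycle: "\<not> (\<exists>p. pre_digraph.cycle (with_proj G) p \<and> length p \<ge> 3)"

definition depth :: "'v pair_pre_digraph \<Rightarrow> 'v \<Rightarrow> 'v \<Rightarrow> nat" where
  "depth G rt x = (LEAST n. \<exists>p. pre_digraph.awalk (with_proj G) rt p x \<and> length p = n)"

definition sphere_card :: "'v pair_pre_digraph \<Rightarrow> 'v \<Rightarrow> nat \<Rightarrow> nat" where
  "sphere_card G rt n = card {x. depth G rt x = n}"

locale infinite_rooted_tree = rooted_tree G rt
  for G :: "'v pair_pre_digraph" and rt :: 'v +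
  assumes infinite_verts: "infinite (UNIV :: 'v set)"
    and finite_spheres: "\<And>n. finite {x. depth G rt x = n}"
    and unbounded_spheres: "\<not> bdd_above (range (sphere_card G rt))"

definition weight_function :: "('v \<Rightarrow> real) \<Rightarrow> bool" where
  "weight_function \<sigma> \<longleftrightarrow> (\<forall>x. \<sigma> x > 0)"

definition weighted_mean ::
    "'v pair_pre_digraph \<Rightarrow> 'v \<Rightarrow> ('v \<Rightarrow> real) \<Rightarrow> real \<Rightarrow> nat \<Rightarrow> ('v \<Rightarrow> complex) \<Rightarrow> real" where
  "weighted_mean G rt \<sigma> p n f =
     (1 / real (sphere_card G rt n) *
        (\<Sum>x | depth G rt x = n. \<sigma> x powr p * cmod (f x) powr p)) powr (1 / p)"

text \<open>The suprema are taken in \<open>ennreal\<close>, so that they may be infinite.\<close>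

definition norm_fin ::
    "'v pair_pre_digraph \<Rightarrow> 'v \<Rightarrow> ('v \<Rightarrow> real) \<Rightarrow> real \<Rightarrow> ('v \<Rightarrow> complex) \<Rightarrow> ennreal" where
  "norm_fin G rt \<sigma> p f = (SUP n. ennreal (weighted_mean G rt \<sigma> p n f))"

definition norm_inf :: "('v \<Rightarrow> real) \<Rightarrow> ('v \<Rightarrow> complex) \<Rightarrow> ennreal" where
  "norm_inf \<sigma> f = (SUP x. ennreal (\<sigma> x * cmod (f x)))"

text \<open>The space \<open>T\<^bsub>\<sigma>,p\<^esub>\<close> is \<open>fn_space (norm_fin G rt \<sigma> p)\<close> for \<open>0 < p < \<infinity>\<close>, and
  \<open>fn_space (norm_inf \<sigma>)\<close> for \<open>p = \<infinity>\<close>.\<close>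

definition fn_space :: "(('v \<Rightarrow> complex) \<Rightarrow> ennreal) \<Rightarrow> ('v \<Rightarrow> complex) set" where
  "fn_space N = {f. N f < \<infinity>}"

definition compact_between ::
    "(('v \<Rightarrow> complex) \<Rightarrow> ennreal) \<Rightarrow> (('v \<Rightarrow> complex) \<Rightarrow> ennreal) \<Rightarrow>
     (('v \<Rightarrow> complex) \<Rightarrow> ('v \<Rightarrow> complex)) \<Rightarrow> bool" where
  "compact_between NX NY A \<longleftrightarrow>
     (\<forall>f \<in> fn_space NX. A f \<in> fn_space NY) \<and>
     (\<forall>f :: nat \<Rightarrow> 'v \<Rightarrow> complex.
        (\<forall>n. f n \<in> fn_space NX) \<and> (\<exists>C :: real. \<forall>n. NX (f n) \<le> ennreal C) \<longrightarrow>
        (\<exists>r g. strict_mono r \<and> g \<in> fn_space NY \<and>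
           (\<lambda>k. NY (\<lambda>x. A (f (r k)) x - g x)) \<longlonglongrightarrow> 0))"

definition weighted_composition ::
    "('v \<Rightarrow> complex) \<Rightarrow> ('v \<Rightarrow> 'v) \<Rightarrow> ('v \<Rightarrow> complex) \<Rightarrow> ('v \<Rightarrow> complex)" where
  "weighted_composition \<psi> \<phi> f = (\<lambda>x. \<psi> x * f (\<phi> x))"

end

theory Submission
  imports Defs "HOL-Complex_Analysis.Great_Picard"
begin

text \<open>Let \<open>h\<^sub>m\<close> be \<open>1 / \<sigma>1\<close> on the vertices of depth at least \<open>m\<close> and \<open>0\<close> elsewhere. The
  expression in the criterion is the \<open>p\<close>-th power of the norm of \<open>W h\<^sub>m\<close>. The \<open>h\<^sub>m\<close> lie in the unit
  ball and tend to \<open>0\<close> pointwise, so compactness forces some subsequence of \<open>W h\<^sub>m\<close> to tend to \<open>0\<close>,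
  and the norms decrease in \<open>m\<close>. Conversely, a bounded sequence has a pointwise convergent
  subsequence. Its error is uniformly small on the finite ball of radius \<open>m\<close>, where \<open>W h\<^sub>0\<close>
  dominates, and bounded outside it, where \<open>W h\<^sub>m\<close> dominates.\<close>

section \<open>Extended norms handled through finite real bounds\<close>

lemma tendsto_zero_ennreal_iff:
  fixes a :: "'a \<Rightarrow> ennreal"
  shows "(a \<longlongrightarrow> 0) F \<longleftrightarrow> (\<forall>e>0. \<forall>\<^sub>F k in F. a k \<le> ennreal e)"
proof
  assume lim: "(a \<longlongrightarrow> 0) F"
  show "\<forall>e>0. \<forall>\<^sub>F k in F. a k \<le> ennreal e"
  proof (intro allI impI)
    fix e :: real assume "0 < e"
    then have "\<forall>\<^sub>F k in F. a k < ennreal e"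
      using lim by (intro order_tendstoD(2)) auto
    then show "\<forall>\<^sub>F k in F. a k \<le> ennreal e"
      by (rule eventually_mono) simp
  qed
next
  assume small: "\<forall>e>0. \<forall>\<^sub>F k in F. a k \<le> ennreal e"
  show "(a \<longlongrightarrow> 0) F"
  proof (rule order_tendstoI)
    fix b :: ennreal assume "0 < b"
    \<comment> \<open>\<open>b\<close> may be infinite. A value \<open>c\<close> strictly between 0
      and \<open>b\<close> is finite, so it supplies a positive real \<open>e\<close> with strict
      room below \<open>b\<close>.\<close>
    then obtain c where c: "0 < c" "c < b"
      using dense by blast
    then obtain e where e: "0 \<le> e" "c = ennreal e"
      by (metis less_top_ennreal order_less_le_trans top_greatest)
    with c have "0 < e" by (simp add: ennreal_less_zero_iff)
    with small have "\<forall>\<^sub>F k in F. a k \<le> ennreal e" by blast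
    then show "\<forall>\<^sub>F k in F. a k < b"
      using c e by (auto elim: eventually_mono)
  qed simp
qed

lemma fn_spaceI: "N f \<le> ennreal C \<Longrightarrow> f \<in> fn_space N"
  by (auto simp: fn_space_def intro: le_less_trans)

lemma fn_space_iff: "f \<in> fn_space N \<longleftrightarrow> (\<exists>C\<ge>0. N f \<le> ennreal C)"
proof
  assume "f \<in> fn_space N"
  then show "\<exists>C\<ge>0. N f \<le> ennreal C"
    by (auto simp: fn_space_def less_top_ennreal)
next
  assume "\<exists>C\<ge>0. N f \<le> ennreal C"
  then show "f \<in> fn_space N" by (auto intro: fn_spaceI)
qed

lemma compact_betweenE:
  fixes f :: "nat \<Rightarrow> 'v \<Rightarrow> complex"
  assumes "compact_between NX NY A"
    and "\<And>n. f n \<in> fn_space NX" and "\<And>n. NX (f n) \<le> ennreal C"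
  obtains r g where "strict_mono r" "g \<in> fn_space NY"
    "(\<lambda>k. NY (\<lambda>x. A (f (r k)) x - g x)) \<longlonglongrightarrow> 0"
proof -
  have "(\<forall>n. f n \<in> fn_space NX) \<and> (\<exists>C. \<forall>n. NX (f n) \<le> ennreal C)"
    using assms(2,3) by (intro conjI allI exI [of _ C])
  with assms(1) [unfolded compact_between_def, THEN conjunct2, THEN spec, of f]
  have "\<exists>r g. strict_mono r \<and> g \<in> fn_space NY \<and>
      (\<lambda>k. NY (\<lambda>x. A (f (r k)) x - g x)) \<longlonglongrightarrow> 0"
    by (rule mp)
  then show thesis using that by (elim exE conjE)
qed

section \<open>Averages over spheres; the p-th powers of the weighted means are of this form\<close>

definition sphere_avg :: "'v pair_pre_digraph \<Rightarrow> 'v \<Rightarrow> nat \<Rightarrow> ('v \<Rightarrow> real) \<Rightarrow> real" where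
  "sphere_avg G rt n g = 1 / real (sphere_card G rt n) * (\<Sum>x | depth G rt x = n. g x)"

lemma sphere_avg_mono:
  "(\<And>x. g x \<le> h x) \<Longrightarrow> sphere_avg G rt n g \<le> sphere_avg G rt n h"
  by (auto simp: sphere_avg_def intro!: divide_right_mono sum_mono)

lemma sphere_avg_nonneg: "(\<And>x. 0 \<le> g x) \<Longrightarrow> 0 \<le> sphere_avg G rt n g"
  by (auto simp: sphere_avg_def intro!: divide_nonneg_nonneg sum_nonneg)

lemma sphere_avg_add:
  "sphere_avg G rt n (\<lambda>x. g x + h x) = sphere_avg G rt n g + sphere_avg G rt n h"
  by (simp add: sphere_avg_def sum.distrib add_divide_distrib)

lemma sphere_avg_cmult: "sphere_avg G rt n (\<lambda>x. c * g x) = c * sphere_avg G rt n g"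
  by (simp add: sphere_avg_def sum_distrib_left [symmetric])

text \<open>The terms are nonnegative, so a single one is at most the sum. The sphere contains
  \<open>x\<close>, so its cardinality is nonzero and cancels.\<close>

lemma le_sphere_avg:
  assumes "finite {y. depth G rt y = depth G rt x}" and "\<And>y. 0 \<le> g y"
  shows "g x \<le> real (sphere_card G rt (depth G rt x)) * sphere_avg G rt (depth G rt x) g"
proof -
  have "sphere_card G rt (depth G rt x) \<noteq> 0"
    using assms(1) by (auto simp: sphere_card_def)
  moreover have "g x \<le> (\<Sum>y | depth G rt y = depth G rt x. g y)"
    using assms by (intro member_le_sum) auto
  ultimately show ?thesis by (simp add: sphere_avg_def)
qed

lemma powr_inverse_le_iff:
  fixes a e p :: real
  assumes "0 < p" "0 \<le> a" "0 \<le> e"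
  shows "a powr (1 / p) \<le> e \<longleftrightarrow> a \<le> e powr p"
proof -
  have "a powr (1 / p) \<le> e \<longleftrightarrow> (a powr (1 / p)) powr p \<le> e powr p"
    using assms by (meson powr_ge_zero powr_mono2 powr_less_mono2 not_le order_less_imp_le)
  then show ?thesis using assms by (simp add: powr_powr)
qed

text \<open>The working form of every \<open>norm_fin\<close> estimate: the supremum becomes a bound
  on each sphere and the root disappears. Estimating p-th powers avoids the triangle inequality for
  \<open>norm_fin\<close>, which may fail when p < 1.\<close>

lemma norm_fin_le_iff:
  assumes "0 < p" "weight_function \<sigma>" "0 \<le> e"
  shows "norm_fin G rt \<sigma> p f \<le> ennreal e \<longleftrightarrow>
    (\<forall>n. sphere_avg G rt n (\<lambda>x. (\<sigma> x * cmod (f x)) powr p) \<le> e powr p)"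
proof -
  have "weighted_mean G rt \<sigma> p n f =
      sphere_avg G rt n (\<lambda>x. (\<sigma> x * cmod (f x)) powr p) powr (1 / p)" for n
    using assms(2) by (simp add: weighted_mean_def sphere_avg_def weight_function_def powr_mult
        less_imp_le)
  then show ?thesis
    using assms by (simp add: norm_fin_def SUP_le_iff powr_inverse_le_iff sphere_avg_nonneg)
qed

lemma norm_inf_le_iff:
  "0 \<le> e \<Longrightarrow> norm_inf \<sigma> f \<le> ennreal e \<longleftrightarrow> (\<forall>x. \<sigma> x * cmod (f x) \<le> e)"
  by (simp add: norm_inf_def SUP_le_iff)

text \<open>Evaluation at a vertex is continuous: by \<open>le_sphere_avg\<close>,
  \<open>(\<sigma> x * cmod (F k x)) powr p\<close> is at most the cardinality of the sphere through
  \<open>x\<close> times the p-th power of any finite bound on the norm.\<close>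

lemma norm_fin_tendsto_zero_pointwise:
  assumes p: "0 < p" and \<sigma>: "weight_function \<sigma>"
    and fin: "finite {y. depth G rt y = depth G rt x}"
    and lim: "((\<lambda>k. norm_fin G rt \<sigma> p (F k)) \<longlongrightarrow> 0) net"
  shows "((\<lambda>k. F k x) \<longlongrightarrow> 0) net"
proof (rule tendstoI)
  fix e :: real assume e: "0 < e"
  define c where "c = real (sphere_card G rt (depth G rt x))"
  have c: "0 < c"
    using fin by (auto simp: c_def sphere_card_def card_gt_0_iff)
  have \<sigma>x: "0 < \<sigma> x" using \<sigma> by (simp add: weight_function_def)
  \<comment> \<open>Chosen so that \<open>c powr (1 / p) * d\<close> equals
    \<open>\<sigma> x * (e / 2)\<close>; the half turns a weak bound into the strict
    \<open>dist (F k x) 0 < e\<close>.\<close>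
  define d where "d = \<sigma> x * e / (2 * c powr (1 / p))"
  have d: "0 < d" using e c \<sigma>x by (simp add: d_def)
  have "\<forall>\<^sub>F k in net. norm_fin G rt \<sigma> p (F k) \<le> ennreal d"
    using lim d by (simp add: tendsto_zero_ennreal_iff)
  then show "\<forall>\<^sub>F k in net. dist (F k x) 0 < e"
  proof (rule eventually_mono)
    fix k assume "norm_fin G rt \<sigma> p (F k) \<le> ennreal d"
    then have "sphere_avg G rt (depth G rt x) (\<lambda>x. (\<sigma> x * cmod (F k x)) powr p) \<le> d powr p"
      using p \<sigma> d by (simp add: norm_fin_le_iff)
    then have "(\<sigma> x * cmod (F k x)) powr p \<le> c * d powr p"
      using le_sphere_avg [OF fin, of "\<lambda>x. (\<sigma> x * cmod (F k x)) powr p"] c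
      unfolding c_def by (meson mult_left_mono of_nat_0_le_iff order_trans powr_ge_zero)
    also have "c * d powr p = (c powr (1 / p) * d) powr p"
      using c d p by (simp add: powr_mult powr_powr)
    also have "c powr (1 / p) * d = \<sigma> x * (e / 2)"
      using c by (simp add: d_def)
    finally have "\<sigma> x * cmod (F k x) \<le> \<sigma> x * (e / 2)"
      using p \<sigma>x e powr_less_mono2 [of p "\<sigma> x * (e / 2)" "\<sigma> x * cmod (F k x)"]
      by (meson divide_pos_pos less_imp_le mult_pos_pos not_le zero_less_numeral)
    then show "dist (F k x) 0 < e" using \<sigma>x e by simp
  qed
qed

section \<open>Weighted composition and the test functions\<close>

lemma weighted_composition_diff:
  "weighted_composition \<psi> \<phi> f x - weighted_composition \<psi> \<phi> g x =
    weighted_composition \<psi> \<phi> (\<lambda>y. f y - g y) x"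
  by (simp add: weighted_composition_def algebra_simps)

text \<open>This is \<open>h_m\<close>. On its support it has the largest modulus that the unit ball
  allows; for \<open>m = 0\<close> the support is the whole tree.\<close>

definition outer_test :: "'v pair_pre_digraph \<Rightarrow> 'v \<Rightarrow> ('v \<Rightarrow> real) \<Rightarrow> nat \<Rightarrow> 'v \<Rightarrow> complex" where
  "outer_test G rt \<sigma> m y = (if m \<le> depth G rt y then complex_of_real (1 / \<sigma> y) else 0)"

lemma outer_test_bounded:
  assumes "weight_function \<sigma>"
  shows "norm_inf \<sigma> (outer_test G rt \<sigma> m) \<le> ennreal 1"
  unfolding norm_inf_le_iff [OF zero_le_one] outer_test_def
  using assms by (auto simp: weight_function_def norm_divide less_imp_le less_imp_neq [symmetric])

text \<open>Where \<open>\<phi> x\<close> has depth below \<open>m\<close> the right-hand terms are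
  \<open>0 powr p = 0\<close>, so the restricted sum extends to the whole sphere.\<close>

lemma outer_test_tail:
  assumes \<sigma>1: "weight_function \<sigma>1" and \<sigma>2: "weight_function \<sigma>2"
    and fin: "finite {x. depth G rt x = n}"
  shows "1 / real (sphere_card G rt n) *
      (\<Sum>x | depth G rt x = n \<and> m \<le> depth G rt (\<phi> x).
         cmod (complex_of_real (\<sigma>2 x) * \<psi> x / complex_of_real (\<sigma>1 (\<phi> x))) powr p) =
    sphere_avg G rt n
      (\<lambda>x. (\<sigma>2 x * cmod (weighted_composition \<psi> \<phi> (outer_test G rt \<sigma>1 m) x)) powr p)"
proof -
  have "(\<Sum>x | depth G rt x = n \<and> m \<le> depth G rt (\<phi> x).
         cmod (complex_of_real (\<sigma>2 x) * \<psi> x / complex_of_real (\<sigma>1 (\<phi> x))) powr p) =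
    (\<Sum>x | depth G rt x = n.
       (\<sigma>2 x * cmod (weighted_composition \<psi> \<phi> (outer_test G rt \<sigma>1 m) x)) powr p)"
    using assms
    by (intro sum.mono_neutral_cong_left)
      (auto simp: weighted_composition_def outer_test_def weight_function_def norm_mult norm_divide
        less_imp_le)
  then show ?thesis by (simp add: sphere_avg_def)
qed

text \<open>A bound \<open>e powr p\<close> on the supremum is a bound \<open>e\<close> on the norm,
  and \<open>e powr p\<close> runs through all positive reals as \<open>e\<close> does.\<close>

lemma outer_test_criterion:
  assumes p: "0 < p" and \<sigma>1: "weight_function \<sigma>1" and \<sigma>2: "weight_function \<sigma>2"
    and fin: "\<And>n. finite {x. depth G rt x = n}"
  shows "(\<lambda>m. SUP n. ennreal (1 / real (sphere_card G rt n) *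
        (\<Sum>x | depth G rt x = n \<and> m \<le> depth G rt (\<phi> x).
           cmod (complex_of_real (\<sigma>2 x) * \<psi> x / complex_of_real (\<sigma>1 (\<phi> x))) powr p)))
      \<longlonglongrightarrow> 0 \<longleftrightarrow>
    (\<lambda>m. norm_fin G rt \<sigma>2 p (weighted_composition \<psi> \<phi> (outer_test G rt \<sigma>1 m))) \<longlonglongrightarrow> 0"
    (is "?T \<longlonglongrightarrow> 0 \<longleftrightarrow> ?N \<longlonglongrightarrow> 0")
proof -
  have tail: "?T m \<le> ennreal (e powr p) \<longleftrightarrow> ?N m \<le> ennreal e" if "0 < e" for m e
    using that by (simp only: outer_test_tail [OF \<sigma>1 \<sigma>2 fin] SUP_le_iff
        norm_fin_le_iff [OF p \<sigma>2 less_imp_le]) (simp add: ennreal_le_iff)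
  show ?thesis
    unfolding tendsto_zero_ennreal_iff
  proof safe
    fix e :: real
    assume "\<forall>e>0. \<forall>\<^sub>F m in sequentially. ?T m \<le> ennreal e" "0 < e"
    then have "\<forall>\<^sub>F m in sequentially. ?T m \<le> ennreal (e powr p)" by simp
    then show "\<forall>\<^sub>F m in sequentially. ?N m \<le> ennreal e"
      unfolding tail [OF \<open>0 < e\<close>] .
  next
    fix e :: real
    assume "\<forall>e>0. \<forall>\<^sub>F m in sequentially. ?N m \<le> ennreal e" and e: "0 < e"
    then have "\<forall>\<^sub>F m in sequentially. ?N m \<le> ennreal (e powr (1 / p))" by simp
    moreover have "(e powr (1 / p)) powr p = e" using p e by (simp add: powr_powr)
    ultimately show "\<forall>\<^sub>F m in sequentially. ?T m \<le> ennreal e"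
      using tail [of "e powr (1 / p)"] e by simp
  qed
qed

text \<open>Raising \<open>m\<close> only replaces more values of the test function by 0. This
  carries smallness from one index of a subsequence to all later indices.\<close>

lemma norm_fin_outer_test_antimono:
  assumes p: "0 < p" and \<sigma>2: "weight_function \<sigma>2" and "m \<le> m'"
    and small: "norm_fin G rt \<sigma>2 p (weighted_composition \<psi> \<phi> (outer_test G rt \<sigma>1 m)) \<le> ennreal e"
    and e: "0 \<le> e"
  shows "norm_fin G rt \<sigma>2 p (weighted_composition \<psi> \<phi> (outer_test G rt \<sigma>1 m')) \<le> ennreal e"
proof -
  have "(\<sigma>2 x * cmod (weighted_composition \<psi> \<phi> (outer_test G rt \<sigma>1 m') x)) powr p
      \<le> (\<sigma>2 x * cmod (weighted_composition \<psi> \<phi> (outer_test G rt \<sigma>1 m) x)) powr p" for x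
    using p \<sigma>2 \<open>m \<le> m'\<close>
    by (auto simp: weighted_composition_def outer_test_def weight_function_def)
  note mono = sphere_avg_mono [OF this]
  show ?thesis
    unfolding norm_fin_le_iff [OF p \<sigma>2 e]
  proof
    fix n
    note mono
    also have "sphere_avg G rt n
        (\<lambda>x. (\<sigma>2 x * cmod (weighted_composition \<psi> \<phi> (outer_test G rt \<sigma>1 m) x)) powr p) \<le> e powr p"
      using small unfolding norm_fin_le_iff [OF p \<sigma>2 e] by (rule spec)
    finally show "sphere_avg G rt n
        (\<lambda>x. (\<sigma>2 x * cmod (weighted_composition \<psi> \<phi> (outer_test G rt \<sigma>1 m') x)) powr p) \<le> e powr p" .
  qed
qed

section \<open>Necessity of the criterion\<close>

lemma compact_imp_outer_test:
  assumes p: "0 < p" and \<sigma>1: "weight_function \<sigma>1" and \<sigma>2: "weight_function \<sigma>2"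
    and fin: "\<And>n. finite {x. depth G rt x = n}"
    and compact: "compact_between (norm_inf \<sigma>1) (norm_fin G rt \<sigma>2 p) (weighted_composition \<psi> \<phi>)"
  shows "(\<lambda>m. norm_fin G rt \<sigma>2 p (weighted_composition \<psi> \<phi> (outer_test G rt \<sigma>1 m))) \<longlonglongrightarrow> 0"
proof -
  let ?W = "weighted_composition \<psi> \<phi>" and ?h = "outer_test G rt \<sigma>1"
  have mem: "\<And>m. ?h m \<in> fn_space (norm_inf \<sigma>1)"
    by (rule fn_spaceI) (rule outer_test_bounded [OF \<sigma>1])
  obtain r g where r: "strict_mono r" and "g \<in> fn_space (norm_fin G rt \<sigma>2 p)"
    and lim: "(\<lambda>k. norm_fin G rt \<sigma>2 p (\<lambda>x. ?W (?h (r k)) x - g x)) \<longlonglongrightarrow> 0"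
    by (rule compact_betweenE [where f = ?h, OF compact mem outer_test_bounded [OF \<sigma>1]])
  \<comment> \<open>For fixed \<open>x\<close>, as soon as \<open>k\<close> exceeds the depth of
    \<open>\<phi> x\<close>, so does \<open>r k\<close>, and \<open>?W (?h (r k)) x\<close>
    vanishes. The difference is then constantly \<open>- g x\<close>, while norm convergence makes
    it tend to 0.\<close>
  have "g x = 0" for x
  proof -
    have "\<forall>\<^sub>F k in sequentially. ?W (?h (r k)) x = 0"
      using eventually_gt_at_top [of "depth G rt (\<phi> x)"]
    proof (rule eventually_mono)
      fix k assume "depth G rt (\<phi> x) < k"
      also have "k \<le> r k" using r by (rule strict_mono_imp_increasing)
      finally show "?W (?h (r k)) x = 0"
        by (simp add: weighted_composition_def outer_test_def)
    qed
    then have "(\<lambda>k. ?W (?h (r k)) x - g x) \<longlonglongrightarrow> 0 - g x"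
      by (intro tendsto_diff tendsto_const tendsto_eventually)
    then show "g x = 0"
      using norm_fin_tendsto_zero_pointwise [OF p \<sigma>2 fin lim, of x] LIMSEQ_unique by fastforce
  qed
  with lim have lim0: "(\<lambda>k. norm_fin G rt \<sigma>2 p (?W (?h (r k)))) \<longlonglongrightarrow> 0" by simp
  show ?thesis
    unfolding tendsto_zero_ennreal_iff
  proof (intro allI impI)
    fix e :: real assume e: "0 < e"
    \<comment> \<open>One good index of the subsequence suffices, by monotonicity in
      \<open>m\<close>.\<close>
    obtain k where k: "norm_fin G rt \<sigma>2 p (?W (?h (r k))) \<le> ennreal e"
      using lim0 e unfolding tendsto_zero_ennreal_iff eventually_sequentially by blast
    show "\<forall>\<^sub>F m in sequentially. norm_fin G rt \<sigma>2 p (?W (?h m)) \<le> ennreal e"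
      using eventually_ge_at_top [of "r k"]
      by (rule eventually_mono) (rule norm_fin_outer_test_antimono [OF p \<sigma>2 _ k less_imp_le [OF e]])
  qed
qed

section \<open>Sufficiency: pointwise limits and their images\<close>

lemma norm_inf_bounded_pointwise_subsequence:
  fixes f :: "nat \<Rightarrow> 'v \<Rightarrow> complex"
  assumes \<sigma>: "weight_function \<sigma>" and count: "countable (UNIV :: 'v set)" and C: "0 \<le> C"
    and bounded: "\<And>n. norm_inf \<sigma> (f n) \<le> ennreal C"
  obtains r g where "strict_mono r" "norm_inf \<sigma> g \<le> ennreal C"
    "\<And>x. (\<lambda>k. f (r k) x) \<longlonglongrightarrow> g x"
proof -
  have \<sigma>pos: "0 < \<sigma> x" for x using \<sigma> by (simp add: weight_function_def)
  have le: "\<sigma> x * cmod (f n x) \<le> C" for n x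
    using bounded C by (simp add: norm_inf_le_iff)
  \<comment> \<open>Absorbing the weight gives all vertices the same bound \<open>C\<close>, as the
    diagonal argument in \<open>function_convergent_subsequence\<close> requires.\<close>
  have "norm (complex_of_real (\<sigma> x) * f n x) \<le> C" for n x
    using le \<sigma>pos [of x] by (simp add: norm_mult)
  with count obtain r where r: "strict_mono r"
    "\<And>x. \<exists>l. (\<lambda>k. complex_of_real (\<sigma> x) * f (r k) x) \<longlonglongrightarrow> l"
    by (rule function_convergent_subsequence [where f = "\<lambda>n x. complex_of_real (\<sigma> x) * f n x"])
      auto
  then obtain l where l: "\<And>x. (\<lambda>k. complex_of_real (\<sigma> x) * f (r k) x) \<longlonglongrightarrow> l x" by metis
  define g where "g x = l x / complex_of_real (\<sigma> x)" for x
  have lim: "(\<lambda>k. f (r k) x) \<longlonglongrightarrow> g x" for x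
  proof -
    have "(\<lambda>k. complex_of_real (\<sigma> x) * f (r k) x / complex_of_real (\<sigma> x)) \<longlonglongrightarrow> g x"
      unfolding g_def using \<sigma>pos [of x] by (intro tendsto_divide l tendsto_const) simp
    then show ?thesis using \<sigma>pos [of x] by simp
  qed
  have "\<sigma> x * cmod (g x) \<le> C" for x
    by (rule LIMSEQ_le_const2 [OF tendsto_mult [OF tendsto_const tendsto_norm [OF lim]]])
      (use le in blast)
  then have "norm_inf \<sigma> g \<le> ennreal C" using C by (simp add: norm_inf_le_iff)
  with r(1) lim show thesis using that by blast
qed

text \<open>Split by the depth of \<open>\<phi> x\<close>. Below \<open>m\<close> the first term is
  already enough; from \<open>m\<close> on the second is, and the other term is nonnegative.\<close>

lemma weighted_composition_le:
  assumes \<sigma>1: "weight_function \<sigma>1" and \<sigma>2: "weight_function \<sigma>2" and p: "0 < p"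
    and outer: "\<And>y. \<sigma>1 y * cmod (h y) \<le> D"
    and inner: "\<And>y. depth G rt y < m \<Longrightarrow> \<sigma>1 y * cmod (h y) \<le> d"
  shows "(\<sigma>2 x * cmod (weighted_composition \<psi> \<phi> h x)) powr p
    \<le> d powr p * (\<sigma>2 x * cmod (weighted_composition \<psi> \<phi> (outer_test G rt \<sigma>1 0) x)) powr p
      + D powr p * (\<sigma>2 x * cmod (weighted_composition \<psi> \<phi> (outer_test G rt \<sigma>1 m) x)) powr p"
proof -
  have pos: "0 < \<sigma>1 (\<phi> x)" "0 < \<sigma>2 x" using \<sigma>1 \<sigma>2 by (auto simp: weight_function_def)
  \<comment> \<open>\<open>w\<close> is the quotient in the criterion and \<open>u\<close> carries
    all dependence on \<open>h\<close>, so that the weighted modulus of the image factors as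
    \<open>u * w\<close>.\<close>
  define w where "w = \<sigma>2 x * cmod (\<psi> x) / \<sigma>1 (\<phi> x)"
  define u where "u = \<sigma>1 (\<phi> x) * cmod (h (\<phi> x))"
  have nonneg: "0 \<le> w" "0 \<le> u" using pos by (auto simp: w_def u_def)
  have W: "\<sigma>2 x * cmod (weighted_composition \<psi> \<phi> h x) = u * w"
    using pos by (simp add: weighted_composition_def w_def u_def norm_mult)
  have T: "\<sigma>2 x * cmod (weighted_composition \<psi> \<phi> (outer_test G rt \<sigma>1 k) x) =
      (if k \<le> depth G rt (\<phi> x) then w else 0)" for k
    using pos by (simp add: weighted_composition_def outer_test_def w_def norm_mult norm_divide)
  have bound: "(u * w) powr p \<le> b powr p * w powr p" if "u \<le> b" for b
    using that nonneg p by (simp add: powr_mult powr_mono2 mult_right_mono)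
  show ?thesis
  proof (cases "m \<le> depth G rt (\<phi> x)")
    case True
    then show ?thesis
      using bound [of D] outer [of "\<phi> x"] by (simp add: W T u_def add_increasing)
  next
    case False
    then show ?thesis
      using bound [of d] inner [of "\<phi> x"] p by (simp add: W T u_def)
  qed
qed

text \<open>Averaging \<open>weighted_composition_le\<close> leaves two terms, each made at most
  \<open>e powr p / 2\<close>: the tail by choosing \<open>m\<close>, then the ball by choosing
  \<open>k\<close> large for that \<open>m\<close>.\<close>

lemma outer_test_imp_continuous:
  assumes p: "0 < p" and \<sigma>1: "weight_function \<sigma>1" and \<sigma>2: "weight_function \<sigma>2"
    and fin: "\<And>n. finite {x. depth G rt x = n}"
    and whole: "weighted_composition \<psi> \<phi> (outer_test G rt \<sigma>1 0) \<in> fn_space (norm_fin G rt \<sigma>2 p)"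
    and tail: "(\<lambda>m. norm_fin G rt \<sigma>2 p (weighted_composition \<psi> \<phi> (outer_test G rt \<sigma>1 m))) \<longlonglongrightarrow> 0"
    and bounded: "\<And>k. norm_inf \<sigma>1 (h k) \<le> ennreal D" and D: "0 \<le> D"
    and lim: "\<And>y. (\<lambda>k. h k y) \<longlonglongrightarrow> 0"
  shows "(\<lambda>k. norm_fin G rt \<sigma>2 p (weighted_composition \<psi> \<phi> (h k))) \<longlonglongrightarrow> 0"
  unfolding tendsto_zero_ennreal_iff
proof (intro allI impI)
  fix e :: real assume e: "0 < e"
  let ?avg = "\<lambda>n f. sphere_avg G rt n (\<lambda>x. (\<sigma>2 x * cmod (weighted_composition \<psi> \<phi> f x)) powr p)"
  obtain B where B: "0 \<le> B"
    and B_norm: "norm_fin G rt \<sigma>2 p (weighted_composition \<psi> \<phi> (outer_test G rt \<sigma>1 0)) \<le> ennreal B"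
    using whole unfolding fn_space_iff by blast
  have B_avg: "?avg n (outer_test G rt \<sigma>1 0) \<le> B powr p" for n
    using B_norm unfolding norm_fin_le_iff [OF p \<sigma>2 B] by blast
  \<comment> \<open>Scaling by \<open>q\<close> halves a p-th power, whatever \<open>p\<close>
    is.\<close>
  define q where "q = (1 / 2) powr (1 / p)"
  have q: "0 < q" "q powr p = 1 / 2" using p by (auto simp: q_def powr_powr)
  \<comment> \<open>Makes \<open>D * s\<close> at most \<open>q * e\<close>; adding 1 keeps the
    denominator positive when \<open>D = 0\<close>. \<open>d\<close> below plays the same role
    against \<open>B\<close>.\<close>
  define s where "s = q * e / (D + 1)"
  have s: "0 < s" using q e D by (simp add: s_def)
  obtain m where
    "norm_fin G rt \<sigma>2 p (weighted_composition \<psi> \<phi> (outer_test G rt \<sigma>1 m)) \<le> ennreal s"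
    using tail s unfolding tendsto_zero_ennreal_iff eventually_sequentially by blast
  then have m: "?avg n (outer_test G rt \<sigma>1 m) \<le> s powr p" for n
    unfolding norm_fin_le_iff [OF p \<sigma>2 less_imp_le [OF s]] by blast
  define d where "d = q * e / (B + 1)"
  have d: "0 < d" using q e B by (simp add: d_def)
  \<comment> \<open>Finiteness of the ball upgrades pointwise convergence to uniform smallness on
    it.\<close>
  have "{y. depth G rt y < m} = (\<Union>n<m. {y. depth G rt y = n})" by auto
  then have "finite {y. depth G rt y < m}" using fin by simp
  moreover have "\<forall>\<^sub>F k in sequentially. \<sigma>1 y * cmod (h k y) \<le> d" for y
  proof -
    have "(\<lambda>k. \<sigma>1 y * cmod (h k y)) \<longlonglongrightarrow> 0"
      using tendsto_mult [OF tendsto_const tendsto_norm [OF lim]] by fastforce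
    from order_tendstoD(2) [OF this d] show ?thesis by (auto elim: eventually_mono)
  qed
  ultimately have "\<forall>\<^sub>F k in sequentially. \<forall>y\<in>{y. depth G rt y < m}. \<sigma>1 y * cmod (h k y) \<le> d"
    by (intro eventually_ball_finite ballI)
  then show "\<forall>\<^sub>F k in sequentially. norm_fin G rt \<sigma>2 p (weighted_composition \<psi> \<phi> (h k)) \<le> ennreal e"
  proof (rule eventually_mono)
    fix k assume inner: "\<forall>y\<in>{y. depth G rt y < m}. \<sigma>1 y * cmod (h k y) \<le> d"
    have outer: "\<sigma>1 y * cmod (h k y) \<le> D" for y
      using bounded [of k] D by (simp add: norm_inf_le_iff)
    have half: "a powr p * (q * e / (a + 1)) powr p \<le> e powr p / 2" if "0 \<le> a" for a
    proof -
      have "a * (q * e / (a + 1)) \<le> q * e"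
        using that q e by (simp add: field_simps)
      then have "(a * (q * e / (a + 1))) powr p \<le> (q * e) powr p"
        using that q e p by (intro powr_mono2) auto
      moreover have "(a * (q * e / (a + 1))) powr p = a powr p * (q * e / (a + 1)) powr p"
        by (rule powr_mult)
      moreover have "(q * e) powr p = e powr p / 2"
        using q e by (simp add: powr_mult)
      ultimately show ?thesis by simp
    qed
    have "?avg n (h k) \<le> e powr p" for n
    proof -
      have "?avg n (h k) \<le> d powr p * ?avg n (outer_test G rt \<sigma>1 0)
          + D powr p * ?avg n (outer_test G rt \<sigma>1 m)"
        unfolding sphere_avg_cmult [symmetric] sphere_avg_add [symmetric]
        using inner by (intro sphere_avg_mono weighted_composition_le [OF \<sigma>1 \<sigma>2 p outer]) auto
      also have "\<dots> \<le> d powr p * B powr p + D powr p * s powr p"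
        by (intro add_mono mult_left_mono B_avg m) auto
      also have "\<dots> \<le> e powr p"
        using half [OF B] half [OF D] by (simp add: d_def s_def mult.commute)
      finally show ?thesis .
    qed
    then show "norm_fin G rt \<sigma>2 p (weighted_composition \<psi> \<phi> (h k)) \<le> ennreal e"
      using norm_fin_le_iff [OF p \<sigma>2 less_imp_le [OF e]] by blast
  qed
qed

section \<open>Assembly of the two implications\<close>

theorem theorem11:
  fixes G :: "'v pair_pre_digraph" and rt :: 'v
    and p :: real
    and \<sigma>1 \<sigma>2 :: "'v \<Rightarrow> real"
    and \<phi> :: "'v \<Rightarrow> 'v" and \<psi> :: "'v \<Rightarrow> complex"
  assumes "infinite_rooted_tree G rt"
    and "0 < p"
    and "weight_function \<sigma>1" and "weight_function \<sigma>2"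
    and operator: "\<forall>f \<in> fn_space (norm_inf \<sigma>1).
      weighted_composition \<psi> \<phi> f \<in> fn_space (norm_fin G rt \<sigma>2 p)"
  shows "compact_between (norm_inf \<sigma>1) (norm_fin G rt \<sigma>2 p) (weighted_composition \<psi> \<phi>) \<longleftrightarrow>
    (\<lambda>m :: nat. SUP n. ennreal (1 / real (sphere_card G rt n) *
        (\<Sum>x | depth G rt x = n \<and> m \<le> depth G rt (\<phi> x).
           cmod (complex_of_real (\<sigma>2 x) * \<psi> x / complex_of_real (\<sigma>1 (\<phi> x))) powr p)))
      \<longlonglongrightarrow> 0"
proof -
  let ?W = "weighted_composition \<psi> \<phi>"
  have fin: "finite {x. depth G rt x = n}" for n
    using assms(1) by (rule infinite_rooted_tree.finite_spheres)
  \<comment> \<open>The tree is a countable union of finite spheres, which makes the diagonal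
    argument available.\<close>
  have "(\<Union>n. {x. depth G rt x = n}) = UNIV" by auto
  moreover have "countable (\<Union>n. {x. depth G rt x = n})"
    using fin by (intro countable_UN) (auto intro: countable_finite)
  ultimately have count: "countable (UNIV :: 'v set)" by simp
  have "compact_between (norm_inf \<sigma>1) (norm_fin G rt \<sigma>2 p) ?W"
    if tail: "(\<lambda>m. norm_fin G rt \<sigma>2 p (?W (outer_test G rt \<sigma>1 m))) \<longlonglongrightarrow> 0"
    unfolding compact_between_def
  proof (intro conjI allI impI operator; elim conjE exE)
    fix f :: "nat \<Rightarrow> 'v \<Rightarrow> complex" and C0 :: real
    assume C0: "\<forall>n. norm_inf \<sigma>1 (f n) \<le> ennreal C0"
    \<comment> \<open>The given bound may be a negative real, which \<open>ennreal\<close> sends to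
      0.\<close>
    define C where "C = max C0 0"
    have C: "0 \<le> C" "norm_inf \<sigma>1 (f n) \<le> ennreal C" for n
      using C0 order_trans [OF spec [OF C0, of n] ennreal_leI [of C0 C]] by (simp_all add: C_def)
    obtain r g where r: "strict_mono r" and g: "norm_inf \<sigma>1 g \<le> ennreal C"
      and lim: "\<And>x. (\<lambda>k. f (r k) x) \<longlonglongrightarrow> g x"
      by (rule norm_inf_bounded_pointwise_subsequence [where f = f, OF assms(3) count C])
        (rule that)
    \<comment> \<open>Continuity will be applied to the errors \<open>f (r k) - g\<close>, so the
      limit of the images is \<open>?W g\<close>.\<close>
    have "norm_inf \<sigma>1 (\<lambda>y. f (r k) y - g y) \<le> ennreal (C + C)" for k
    proof -
      have "\<sigma>1 y * cmod (f (r k) y - g y) \<le> C + C" for y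
      proof -
        have "0 < \<sigma>1 y" using assms(3) by (simp add: weight_function_def)
        then have "\<sigma>1 y * cmod (f (r k) y - g y) \<le> \<sigma>1 y * (cmod (f (r k) y) + cmod (g y))"
          by (simp add: norm_triangle_ineq4)
        also have "\<dots> \<le> C + C"
          using C g unfolding distrib_left by (intro add_mono) (simp_all add: norm_inf_le_iff)
        finally show ?thesis .
      qed
      then show ?thesis using C(1) by (simp add: norm_inf_le_iff del: ennreal_plus)
    qed
    \<comment> \<open>\<open>h_0\<close> lies in the unit ball, so the mapping hypothesis makes the
      norm of its image finite; this controls the part over the finite ball.\<close>
    moreover have "?W (outer_test G rt \<sigma>1 0) \<in> fn_space (norm_fin G rt \<sigma>2 p)"
      by (rule bspec [OF operator]) (rule fn_spaceI, rule outer_test_bounded [OF assms(3)])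
    moreover have "(\<lambda>k. f (r k) y - g y) \<longlonglongrightarrow> 0" for y
      using lim by (simp add: LIM_zero)
    ultimately have "(\<lambda>k. norm_fin G rt \<sigma>2 p (?W (\<lambda>y. f (r k) y - g y))) \<longlonglongrightarrow> 0"
      by (intro outer_test_imp_continuous [OF assms(2-4) fin _ tail, where D = "C + C"])
        (use C(1) in auto)
    moreover have "?W g \<in> fn_space (norm_fin G rt \<sigma>2 p)"
      by (rule bspec [OF operator]) (rule fn_spaceI, rule g)
    ultimately show "\<exists>r g. strict_mono r \<and> g \<in> fn_space (norm_fin G rt \<sigma>2 p) \<and>
        (\<lambda>k. norm_fin G rt \<sigma>2 p (\<lambda>x. ?W (f (r k)) x - g x)) \<longlonglongrightarrow> 0"
      using r by (intro exI [of _ r] exI [of _ "?W g"]) (simp add: weighted_composition_diff)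
  qed
  then show ?thesis
    unfolding outer_test_criterion [OF assms(2-4) fin]
    using compact_imp_outer_test [OF assms(2-4) fin] by blast
qed

end
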